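(* Let $I=\{0,1,2,\dots\}$ and, for $t\ge 0$, let $A^{[t]}$ be the two-dimensional real algebra with basis $e_1,e_2$ and products $$e_1e_1=\cos t\,e_1+\sin t\,e_2,\quad e_1e_2=\cos t\,e_1-\sin t\,e_2,\quad e_2e_1=-\sin t\,e_1+\cos t\,e_2,\quad e_2e_2=\sin t\,e_1+\cos t\,e_2 .$$ Then, with the algebras $A_1$, $A_0^{+}$, $A_2$, $A_c^{+}$, $A_c^{-}$ defined in the context, $$A^{[t]}\cong\begin{cases} A_1, & \text{if } t\in\{\pi k: k\in I\},\\ A_0^{+}, & \text{if } t\in\{\tfrac{\pi}{2}+\pi k: k\in I\},\\ A_2, & \text{if } t\in\{\tfrac{3\pi}{4}+\pi k: k\in I\},\\ A_{|\cos t|}^{+}, & \text{if } t\in\bigcup_{k\in I}\left(\pi k,\ \tfrac{\pi}{2}+\pi k\right),\\ A_{|\cos t|}^{-}, & \text{if } t\in\bigcup_{k\in I}\left(\left(\tfrac{\pi}{2}+\pi k,\ \pi+\pi k\right)\setminus\{\tfrac{3\pi}{4}+\pi k\}\right). \end{cases}$$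
   Context: All algebras are over $\mathbb{R}$; an algebra is a real vector space with a bilinear product (not assumed associative, commutative or unital), and $\cong$ means there is a linear bijection preserving products. Each of the following is the two-dimensional algebra with basis $e_1,e_2$ and the products indicated. - $A_1$: $e_1e_1=e_1,\ e_1e_2=e_1,\ e_2e_1=e_2,\ e_2e_2=e_2$. - $A_0^{+}$: $e_1e_1=e_2,\ e_1e_2=-e_2,\ e_2e_1=-e_1,\ e_2e_2=e_1$. - $A_2$: $e_1e_1=\frac{\sqrt2}{2}(e_1-e_2),\ e_1e_2=e_2e_1=\frac{\sqrt2}{2}(e_1+e_2),\ e_2e_2=\frac{\sqrt2}{2}(-e_1+e_2)$. - For $c\in(-1,1)\setminus\{0\}$ and $\sigma=\sqrt{1-c^2}$ (for $A_c^{+}$), respectively $\sigma=-\sqrt{1-c^2}$ (for $A_c^{-}$): $e_1e_1=c\,e_1+\sigma e_2,\ e_1e_2=c\,e_1-\sigma e_2,\ e_2e_1=-\sigma e_1+c\,e_2,\ e_2e_2=\sigma e_1+c\,e_2$. *)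

theory Defs
  imports "HOL-Analysis.Analysis"
begin

text \<open>
  An algebra structure on a real vector space is represented by its (bilinear) product.
\<close>

definition alg_iso ::
    "('a::real_vector \<Rightarrow> 'a \<Rightarrow> 'a) \<Rightarrow> ('b::real_vector \<Rightarrow> 'b \<Rightarrow> 'b) \<Rightarrow> bool"
    (infix "\<cong>\<^sub>a" 50) where
  "m \<cong>\<^sub>a m' \<longleftrightarrow> (\<exists>f. linear f \<and> bij f \<and> (\<forall>x y. f (m x y) = m' (f x) (f y)))"

definition e1 :: "real^2" where "e1 = axis 1 1"
definition e2 :: "real^2" where "e2 = axis 2 1"

text \<open>
  The arguments of \<open>table_alg\<close> are the products
  \<open>e1 e1\<close>, \<open>e1 e2\<close>, \<open>e2 e1\<close>, \<open>e2 e2\<close>, in this order.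
\<close>

definition table_alg ::
    "real^2 \<Rightarrow> real^2 \<Rightarrow> real^2 \<Rightarrow> real^2 \<Rightarrow> (real^2 \<Rightarrow> real^2 \<Rightarrow> real^2)" where
  "table_alg p11 p12 p21 p22 x y =
     (x$1 * y$1) *\<^sub>R p11 + (x$1 * y$2) *\<^sub>R p12 + (x$2 * y$1) *\<^sub>R p21 + (x$2 * y$2) *\<^sub>R p22"

lemma bilinear_table_alg: "bilinear (table_alg p11 p12 p21 p22)"
  unfolding bilinear_def table_alg_def
  by (auto intro!: linearI simp: algebra_simps)

lemma table_alg_basis:
  "table_alg p11 p12 p21 p22 e1 e1 = p11"
  "table_alg p11 p12 p21 p22 e1 e2 = p12"
  "table_alg p11 p12 p21 p22 e2 e1 = p21"
  "table_alg p11 p12 p21 p22 e2 e2 = p22"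
  by (simp_all add: table_alg_def e1_def e2_def axis_def)

definition A1 :: "real^2 \<Rightarrow> real^2 \<Rightarrow> real^2" where
  "A1 = table_alg e1 e1 e2 e2"

definition A0_plus :: "real^2 \<Rightarrow> real^2 \<Rightarrow> real^2" where
  "A0_plus = table_alg e2 (- e2) (- e1) e1"

definition A2 :: "real^2 \<Rightarrow> real^2 \<Rightarrow> real^2" where
  "A2 = table_alg ((sqrt 2 / 2) *\<^sub>R (e1 - e2)) ((sqrt 2 / 2) *\<^sub>R (e1 + e2))
                  ((sqrt 2 / 2) *\<^sub>R (e1 + e2)) ((sqrt 2 / 2) *\<^sub>R (- e1 + e2))"

definition cs_alg :: "real \<Rightarrow> real \<Rightarrow> real^2 \<Rightarrow> real^2 \<Rightarrow> real^2" where
  "cs_alg c s = table_alg (c *\<^sub>R e1 + s *\<^sub>R e2) (c *\<^sub>R e1 - s *\<^sub>R e2)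
                          (- s *\<^sub>R e1 + c *\<^sub>R e2) (s *\<^sub>R e1 + c *\<^sub>R e2)"

text \<open>
  The families \<open>Ac_plus\<close> and \<open>Ac_minus\<close> are meant for parameters \<open>c \<in> {-1<..<1} - {0}\<close> only.
\<close>

definition Ac_plus :: "real \<Rightarrow> real^2 \<Rightarrow> real^2 \<Rightarrow> real^2" where
  "Ac_plus c = cs_alg c (sqrt (1 - c\<^sup>2))"

definition Ac_minus :: "real \<Rightarrow> real^2 \<Rightarrow> real^2 \<Rightarrow> real^2" where
  "Ac_minus c = cs_alg c (- sqrt (1 - c\<^sup>2))"

definition At :: "real \<Rightarrow> real^2 \<Rightarrow> real^2 \<Rightarrow> real^2" where
  "At t = cs_alg (cos t) (sin t)"

lemma cases_exhaustive:
  fixes t :: real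
  assumes "t \<ge> 0"
  shows "t \<in> {pi * real k | k :: nat. True}
       \<union> {pi / 2 + pi * real k | k :: nat. True}
       \<union> {3 * pi / 4 + pi * real k | k :: nat. True}
       \<union> (\<Union>k::nat. {pi * k <..< pi / 2 + pi * k})
       \<union> (\<Union>k::nat. {pi / 2 + pi * k <..< pi + pi * k} - {3 * pi / 4 + pi * k})"
proof -
  define k where "k = nat \<lfloor>t / pi\<rfloor>"
  have k: "real k = of_int \<lfloor>t / pi\<rfloor>"
    using assms by (simp add: k_def)
  have "real k \<le> t / pi" "t / pi < real k + 1"
    unfolding k by linarith+
  hence lo: "pi * k \<le> t" and hi: "t < pi + pi * k"
    by (simp_all add: field_simps)
  consider "t = pi * k" | "t = pi / 2 + pi * k" | "t = 3 * pi / 4 + pi * k"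
    | "t \<in> {pi * k <..< pi / 2 + pi * k}"
    | "t \<in> {pi / 2 + pi * k <..< pi + pi * k} - {3 * pi / 4 + pi * k}"
    using lo hi by force
  thus ?thesis by cases blast+
qed

end

theory Submission imports Defs begin

text \<open>
  Since \<open>- id\<close> is an isomorphism from a product \<open>m\<close> to \<open>- m\<close>, and shifting \<open>t\<close> by \<open>\<pi>\<close> negates both
  \<open>cos t\<close> and \<open>sin t\<close>, the isomorphism class of \<open>At t\<close> is \<open>\<pi>\<close>-periodic in \<open>t\<close>. Taking representatives
  \<open>u \<in> {-\<pi>/2<..\<pi>/2}\<close>, where \<open>cos u \<ge> 0\<close>, the table of \<open>At u\<close> is literally the required one.
\<close>

lemma alg_iso_refl: "m \<cong>\<^sub>a m"
  unfolding alg_iso_def by (intro exI[of _ "\<lambda>x. x"]) (simp add: linear_iff bij_def)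

text \<open>The witness is negation: bilinearity gives \<open>(- x)(- y) = x y\<close>, so the sign
  left over is absorbed by negating both structure constants.\<close>

lemma cs_alg_iso_uminus: "cs_alg c s \<cong>\<^sub>a cs_alg (- c) (- s)"
  unfolding alg_iso_def
proof (intro exI conjI allI)
  show "linear (uminus :: real^2 \<Rightarrow> real^2)" by (simp add: linear_iff)
  show "bij (uminus :: real^2 \<Rightarrow> real^2)" by (rule bij_uminus)
  show "- cs_alg c s x y = cs_alg (- c) (- s) (- x) (- y)" for x y
    by (simp add: cs_alg_def table_alg_def algebra_simps)
qed

lemma At_iso_shift:
  fixes k :: int
  shows "At (u + pi * of_int k) \<cong>\<^sub>a At u"
  \<comment> \<open>For odd \<open>k\<close> the shift negates \<open>cos u\<close> and
    \<open>sin u\<close>; starting from these negated values, the isomorphism ends at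
    \<open>At u\<close>. For even \<open>k\<close> the two products coincide.\<close>
  using cs_alg_iso_uminus[of "- cos u" "- sin u"]
  by (cases "even k") (simp_all add: At_def cos_add sin_add alg_iso_refl)

lemma abs_cos_shift:
  fixes k :: int
  shows "\<bar>cos (u + pi * of_int k)\<bar> = \<bar>cos u\<bar>"
  by (simp add: cos_add)

lemma At_0: "At 0 = A1"
  by (simp add: At_def cs_alg_def A1_def)

lemma At_pi_half: "At (pi / 2) = A0_plus"
  by (simp add: At_def cs_alg_def A0_plus_def)

lemma At_minus_pi_quarter: "At (- (pi / 4)) = A2"
  by (simp add: At_def cs_alg_def A2_def cos_45 sin_45 algebra_simps)

text \<open>In the first quadrant \<open>sqrt (1 - (cos u)\<^sup>2) = \<bar>sin u\<bar>\<close> is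
  \<open>sin u\<close> itself.\<close>

lemma At_eq_Ac_plus:
  assumes "0 \<le> u" "u \<le> pi / 2"
  shows "At u = Ac_plus \<bar>cos u\<bar>"
proof -
  have "cos u \<ge> 0" "sin u \<ge> 0"
    using assms by (auto intro: cos_ge_zero sin_ge_zero)
  then show ?thesis
    by (simp add: At_def Ac_plus_def flip: sin_squared_eq)
qed

text \<open>In the fourth quadrant \<open>sin u\<close> is nonpositive, so the negated root
  \<open>- \<bar>sin u\<bar>\<close> recovers it.\<close>

lemma At_eq_Ac_minus:
  assumes "- (pi / 2) \<le> u" "u \<le> 0"
  shows "At u = Ac_minus \<bar>cos u\<bar>"
proof -
  have "cos u \<ge> 0"
    using assms by (auto intro: cos_ge_zero)
  moreover have "sin u \<le> 0"
    using sin_ge_zero[of "- u"] assms by simp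
  ultimately show ?thesis
    by (simp add: At_def Ac_minus_def flip: sin_squared_eq)
qed

theorem theorem3:
  fixes t :: real
  assumes "t \<ge> 0"
  shows "(t \<in> {pi * real k | k :: nat. True} \<longrightarrow> At t \<cong>\<^sub>a A1)
       \<and> (t \<in> {pi / 2 + pi * real k | k :: nat. True} \<longrightarrow> At t \<cong>\<^sub>a A0_plus)
       \<and> (t \<in> {3 * pi / 4 + pi * real k | k :: nat. True} \<longrightarrow> At t \<cong>\<^sub>a A2)
       \<and> (t \<in> (\<Union>k::nat. {pi * real k <..< pi / 2 + pi * real k})
            \<longrightarrow> At t \<cong>\<^sub>a Ac_plus \<bar>cos t\<bar>)
       \<and> (t \<in> (\<Union>k::nat. {pi / 2 + pi * real k <..< pi + pi * real k} - {3 * pi / 4 + pi * real k})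
            \<longrightarrow> At t \<cong>\<^sub>a Ac_minus \<bar>cos t\<bar>)"
proof (intro conjI impI)
  assume "t \<in> {pi * real k | k :: nat. True}"
  then obtain k :: nat where "t = 0 + pi * of_int (int k)" by auto
  then show "At t \<cong>\<^sub>a A1" using At_iso_shift[of 0 "int k"] by (simp only: At_0)
next
  assume "t \<in> {pi / 2 + pi * real k | k :: nat. True}"
  then obtain k :: nat where "t = pi / 2 + pi * of_int (int k)" by auto
  then show "At t \<cong>\<^sub>a A0_plus" using At_iso_shift[of "pi / 2" "int k"] by (simp only: At_pi_half)
next
  assume "t \<in> {3 * pi / 4 + pi * real k | k :: nat. True}"
  then obtain k :: nat where "t = 3 * pi / 4 + pi * real k" by auto
  \<comment> \<open>As \<open>3 * pi / 4 = - (pi / 4) + pi\<close>, the representative with positive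
    cosine costs one extra period.\<close>
  then have "t = - (pi / 4) + pi * of_int (int k + 1)" by (simp add: field_simps)
  then show "At t \<cong>\<^sub>a A2" using At_iso_shift[of "- (pi / 4)" "int k + 1"] by (simp only: At_minus_pi_quarter)
next
  assume "t \<in> (\<Union>k::nat. {pi * real k <..< pi / 2 + pi * real k})"
  then obtain k :: nat where k: "pi * real k < t" "t < pi / 2 + pi * real k" by auto
  define u where "u = t - pi * of_int (int k)"
  have t: "t = u + pi * of_int (int k)" by (simp add: u_def)
  have "0 \<le> u" "u \<le> pi / 2" using k by (simp_all add: u_def)
  then have "At u = Ac_plus \<bar>cos u\<bar>" by (rule At_eq_Ac_plus)
  then show "At t \<cong>\<^sub>a Ac_plus \<bar>cos t\<bar>"
    using At_iso_shift[of u "int k"] unfolding t abs_cos_shift by (simp only:)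
next
  assume "t \<in> (\<Union>k::nat. {pi / 2 + pi * real k <..< pi + pi * real k} - {3 * pi / 4 + pi * real k})"
  then obtain k :: nat where k: "pi / 2 + pi * real k < t" "t < pi + pi * real k" by auto
  \<comment> \<open>Subtracting \<open>k + 1\<close> periods instead of \<open>k\<close> moves
    \<open>u\<close> from the second quadrant to the fourth, where the cosine is
    nonnegative.\<close>
  define u where "u = t - pi * of_int (int k + 1)"
  have t: "t = u + pi * of_int (int k + 1)" by (simp add: u_def)
  have "- (pi / 2) \<le> u" "u \<le> 0" using k by (simp_all add: u_def algebra_simps)
  then have "At u = Ac_minus \<bar>cos u\<bar>" by (rule At_eq_Ac_minus)
  then show "At t \<cong>\<^sub>a Ac_minus \<bar>cos t\<bar>"
    using At_iso_shift[of u "int k + 1"] unfolding t abs_cos_shift by (simp only:)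
qed

end
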